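(* Let $N\ge 2$ and let $W\in\mathbb{R}^{N\times N}$ be the weighted adjacency matrix of a strongly connected directed graph on $\{1,\dots,N\}$, such that $W$ has strictly positive diagonal entries and is row stochastic. Let $q\in\mathbb{R}^N_{>0}$ be the left Perron-Frobenius eigenvector of $W$ ($q^\top W=q^\top$, $\mathbf 1_N^\top q=1$), let $Q:=\mathrm{diag}(q_1,\dots,q_N)$, and let $\bar\sigma:=\sigma_{N-1}(Q^{1/2}WQ^{-1/2})$. Then $\bar\sigma<1$ and, for any $y\in\mathbb{R}^N$, $$\|W(y-\mathbf 1_N q^\top y)\|_Q\le \bar\sigma\,\|y-\mathbf 1_N q^\top y\|_Q .$$
   Context: The directed graph is $\mathcal G(\mathcal I,\mathcal E)$ with $\mathcal I=\{1,\dots,N\}$; its weighted adjacency matrix $W$ has entries $w_{i,j}=[W]_{i,j}$ with $w_{i,j}>0$ if $(i,j)\in\mathcal E$ and $w_{i,j}=0$ otherwise. Self-loops: $w_{i,i}>0$ for all $i$. Row stochasticity: $W\mathbf 1_N=\mathbf 1_N$, where $\mathbf 1_N\in\mathbb R^N$ is the all-ones vector. Under these conditions, by the Perron-Frobenius theorem, there is a unique vector $q$ with strictly positive entries such that $q^\top W=q^\top$ and $\mathbf 1_N^\top q=1$. For a positive definite matrix $P$, $\|x\|_P:=\sqrt{x^\top P x}$. For an $N\times N$ matrix $A$, $\sigma_1(A)\le\dots\le\sigma_N(A)$ denote its singular values in nondecreasing order, so $\sigma_{N-1}(A)$ is the second largest (counted with multiplicity). *)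

theory Defs
  imports
    "HOL-Analysis.Analysis"
    "HOL-Computational_Algebra.Polynomial"
    "Graph_Theory.Digraph_Component"
begin

definition weighted_adjacency_matrix :: "'n pair_pre_digraph \<Rightarrow> real^'n^'n \<Rightarrow> bool" where
  "weighted_adjacency_matrix G W \<longleftrightarrow>
     (\<forall>i j. ((i, j) \<in> parcs G \<longrightarrow> W $ i $ j > 0) \<and> ((i, j) \<notin> parcs G \<longrightarrow> W $ i $ j = 0))"

text \<open>The numeral \<^term>\<open>1 :: real^'n\<close> is the all-ones vector (componentwise unit).\<close>

definition row_stochastic :: "real^'n^'n \<Rightarrow> bool" where
  "row_stochastic W \<longleftrightarrow> (\<forall>i j. W $ i $ j \<ge> 0) \<and> W *v 1 = 1"

definition left_perron_vector :: "real^'n^'n \<Rightarrow> real^'n \<Rightarrow> bool" where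
  "left_perron_vector W q \<longleftrightarrow> (\<forall>i. q $ i > 0) \<and> q v* W = q \<and> 1 \<bullet> q = 1"

definition diag_mat :: "real^'n \<Rightarrow> real^'n^'n" where
  "diag_mat d = (\<chi> i j. if i = j then d $ i else 0)"

definition weighted_norm :: "real^'n^'n \<Rightarrow> real^'n \<Rightarrow> real" where
  "weighted_norm P x = sqrt (x \<bullet> (P *v x))"

definition charpoly :: "real^'n^'n \<Rightarrow> real poly" where
  "charpoly A = det (\<chi> i j. (if i = j then [:0, 1:] else 0) - [:A $ i $ j:])"

text \<open>
  The square roots of the eigenvalues of \<open>A\<^sup>T A\<close>, in nondecreasing order and with multiplicity.
  Since \<open>A\<^sup>T A\<close> is symmetric positive semidefinite, its characteristic polynomial has only
  nonnegative real roots, so taking the roots over the reals loses none of them and the list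
  has exactly \<^term>\<open>CARD('n)\<close> entries.
\<close>

definition singular_values :: "real^'n^'n \<Rightarrow> real list" where
  "singular_values A =
     sorted_list_of_multiset (image_mset sqrt (proots (charpoly (transpose A ** A))))"

text \<open>
  One-based indexing, for \<open>1 \<le> k \<le> CARD('n)\<close>:
  the largest singular value is the one with index \<^term>\<open>CARD('n)\<close>.
\<close>

definition singular_value :: "nat \<Rightarrow> real^'n^'n \<Rightarrow> real" where
  "singular_value k A = singular_values A ! (k - 1)"

end

theory Submission
  imports Defs
begin

text \<open>
  Put \<open>A = Q\<^sup>1\<^sup>/\<^sup>2 W Q\<^sup>-\<^sup>1\<^sup>/\<^sup>2\<close> and \<open>v = (\<surd>q\<^sub>i)\<^sub>i\<close>. Then \<open>v\<close> is a unit vector fixed by both \<open>A\<close> and \<open>A\<^sup>T\<close>, so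
  \<open>A\<^sup>T A\<close> preserves \<open>v\<^sup>\<bottom>\<close> and is diagonalised there by an orthonormal basis. By Jensen's inequality
  \<open>W\<close> does not increase the \<open>Q\<close>-norm, and equality forces \<open>z\<^sub>i = z\<^sub>j\<close> along every arc (this uses the
  self-loops), hence \<open>z\<close> constant by strong connectivity, hence \<open>z = 0\<close> if \<open>q\<^sup>T z = 0\<close>. So all eigenvalues
  on \<open>v\<^sup>\<bottom>\<close> lie in \<open>[0, 1)\<close>, the top singular value is the \<open>1\<close> of \<open>v\<close>, and \<open>\<sigma>\<close> is the norm of \<open>A\<close>
  on \<open>v\<^sup>\<bottom>\<close>, which \<open>y - (q\<^sup>T y) 1\<close> lands in after multiplication by \<open>Q\<^sup>1\<^sup>/\<^sup>2\<close>.
\<close>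

subsection \<open>The spectral theorem for self-adjoint maps\<close>

text \<open>A maximiser \<open>x\<close> of the Rayleigh quotient on the compact unit sphere of
  \<open>V\<close> is an eigenvector: if the residual \<open>r = l x - f x\<close> were nonzero, a
  small move from \<open>x\<close> along \<open>- r\<close> would raise the quotient.\<close>

lemma self_adjoint_eigenvector:
  fixes f :: "'a::euclidean_space \<Rightarrow> 'a"
  assumes lin: "linear f" and adj: "\<And>x y. f x \<bullet> y = x \<bullet> f y"
    and V: "subspace V" "\<And>x. x \<in> V \<Longrightarrow> f x \<in> V" "V \<noteq> {0}"
  obtains x l where "x \<in> V" "norm x = 1" "f x = l *\<^sub>R x"
proof -
  obtain a where a: "a \<in> V" "a \<noteq> 0"
    using V subspace_0 by blast
  have "a /\<^sub>R norm a \<in> sphere 0 1 \<inter> V"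
    using a V(1) by (auto simp: subspace_scale)
  moreover have "compact (sphere 0 1 \<inter> V)"
    using V(1) by (intro compact_Int_closed closed_subspace) auto
  moreover have "continuous_on (sphere 0 1 \<inter> V) (\<lambda>x. f x \<bullet> x)"
    by (intro continuous_on_inner linear_continuous_on continuous_on_id lin[THEN linear_conv_bounded_linear[THEN iffD1]])
  ultimately obtain x where x: "x \<in> sphere 0 1 \<inter> V"
    and max: "\<And>y. y \<in> sphere 0 1 \<inter> V \<Longrightarrow> f y \<bullet> y \<le> f x \<bullet> x"
    using continuous_attains_sup[of "sphere 0 1 \<inter> V" "\<lambda>x. f x \<bullet> x"] by blast
  define l where "l = f x \<bullet> x"
  have xx: "x \<bullet> x = 1" "x \<in> V" "norm x = 1"
    using x by (auto simp: dot_square_norm)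
  have bound: "f y \<bullet> y \<le> l * (y \<bullet> y)" if "y \<in> V" for y
  proof (cases "y = 0")
    case False
    have "y /\<^sub>R norm y \<in> sphere 0 1 \<inter> V"
      using that False V(1) by (auto simp: subspace_scale)
    from max[OF this] have "(f y \<bullet> y) / (norm y)\<^sup>2 \<le> l"
      by (simp add: linear_scale[OF lin] l_def power2_eq_square field_simps)
    then show ?thesis
      using False by (simp add: dot_square_norm field_simps)
  qed (simp add: linear_0[OF lin])
  define r where "r = l *\<^sub>R x - f x"
  have rV: "r \<in> V"
    unfolding r_def using V xx by (intro subspace_diff subspace_scale) auto
  have rx: "r \<bullet> x = 0" "x \<bullet> r = 0"
    by (simp_all add: r_def inner_diff_left inner_diff_right l_def xx inner_commute)
  have fxr: "f x \<bullet> r = - (r \<bullet> r)"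
  proof -
    have "r \<bullet> r = l * (x \<bullet> r) - f x \<bullet> r"
      by (subst (1) r_def) (simp add: inner_diff_left)
    then show ?thesis using rx by simp
  qed
  define R where "R = r \<bullet> r"
  define p where "p = l * R - f r \<bullet> r"
  \<comment> \<open>The bound at \<open>x - s r\<close> reads \<open>2 s R <= s^2 p\<close>. This
    \<open>s\<close> turns it into \<open>s^2 (2 + p) <= 0\<close>; the summand 1 keeps the
    denominator positive even when \<open>p\<close> is 0.\<close>
  define s where "s = R / (1 + p)"
  have p: "p \<ge> 0" using bound[OF rV] by (simp add: p_def R_def)
  have "x - s *\<^sub>R r \<in> V"
    using V xx rV by (intro subspace_diff subspace_scale) auto
  from bound[OF this] have "2 * s * R \<le> s\<^sup>2 * p"
    using rx fxr xx adj[of r x]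
    by (simp add: linear_diff[OF lin] linear_scale[OF lin] inner_diff_left inner_diff_right
        inner_commute[of x "f x"] inner_commute[of r "f x"] l_def[symmetric] R_def p_def power2_eq_square algebra_simps)
  moreover have R: "R = s * (1 + p)" using p by (simp add: s_def)
  ultimately have "s\<^sup>2 * (2 + p) \<le> 0" by (simp add: power2_eq_square algebra_simps)
  then have "s = 0" using p by (simp add: mult_le_0_iff)
  then have "R = 0" using R by simp
  then have "f x = l *\<^sub>R x" by (simp add: R_def r_def)
  then show thesis using that xx by blast
qed

text \<open>Split off one unit eigenvector; by self-adjointness its orthogonal complement in
  \<open>V\<close> is again invariant, and its dimension is smaller. Working with invariant
  subspaces serves this induction and the later application to the complement of
  \<open>v\<close>.\<close>

theorem self_adjoint_orthonormal_eigenbasis: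
  fixes f :: "'a::euclidean_space \<Rightarrow> 'a"
  assumes lin: "linear f" and adj: "\<And>x y. f x \<bullet> y = x \<bullet> f y"
    and "subspace V" "\<And>x. x \<in> V \<Longrightarrow> f x \<in> V"
  shows "\<exists>B\<subseteq>V. finite B \<and> pairwise orthogonal B \<and> (\<forall>b\<in>B. norm b = 1) \<and> span B = V \<and>
           (\<forall>b\<in>B. \<exists>l. f b = l *\<^sub>R b)"
  using assms(3,4)
proof (induction "dim V" arbitrary: V rule: less_induct)
  case less
  show ?case
  proof (cases "V = {0}")
    case True
    then show ?thesis by (intro exI[of _ "{}"]) auto
  next
    case False
    obtain x l where x: "x \<in> V" "norm x = 1" "f x = l *\<^sub>R x"
      using self_adjoint_eigenvector[OF lin adj less.prems False] by blast
    have xx: "x \<bullet> x = 1" using x by (simp add: dot_square_norm)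
    define V' where "V' = {y \<in> V. x \<bullet> y = 0}"
    have sub: "subspace V'"
      using less.prems(1) by (auto simp: V'_def subspace_def inner_add_right)
    have inv: "f y \<in> V'" if "y \<in> V'" for y
      using that less.prems(2) adj[of x y] x by (auto simp: V'_def)
    have "V' \<subset> V" using x xx by (force simp: V'_def)
    then have "dim V' < dim V"
      using sub less.prems(1) by (intro dim_psubset) (metis span_eq_iff)
    from less.hyps[OF this sub inv] obtain B where B: "B \<subseteq> V'" "finite B" "pairwise orthogonal B"
      "\<forall>b\<in>B. norm b = 1" "span B = V'" "\<forall>b\<in>B. \<exists>l. f b = l *\<^sub>R b"
      by blast
    have "V \<subseteq> span (insert x B)"
    proof
      fix y assume "y \<in> V"
      then have "y - (x \<bullet> y) *\<^sub>R x \<in> V'"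
        using x xx less.prems(1) by (auto simp: V'_def subspace_diff subspace_scale inner_diff_right)
      then show "y \<in> span (insert x B)"
        using B(5) span_breakdown_eq by blast
    qed
    moreover have "insert x B \<subseteq> V" using B(1) x by (auto simp: V'_def)
    ultimately have "span (insert x B) = V"
      using less.prems(1) by (metis span_subspace)
    moreover have "pairwise orthogonal (insert x B)"
      using B(1,3) by (auto simp: pairwise_insert orthogonal_def V'_def inner_commute)
    ultimately show ?thesis
      using B x \<open>insert x B \<subseteq> V\<close> by (intro exI[of _ "insert x B"]) auto
  qed
qed

lemma orthonormal_inner:
  assumes "pairwise orthogonal B" "\<forall>b\<in>B. norm b = 1" "b \<in> B" "c \<in> B"
  shows "b \<bullet> c = (if b = c then 1 else 0)"
  using assms by (auto simp: pairwise_def orthogonal_def dot_square_norm)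

lemma orthonormal_expansion:
  fixes B :: "'a::real_inner set"
  assumes "finite B" "pairwise orthogonal B" "\<forall>b\<in>B. norm b = 1" "x \<in> span B"
  shows "x = (\<Sum>b\<in>B. (x \<bullet> b) *\<^sub>R b)"
  using assms(4)
proof (induction rule: span_induct_alt)
  case (step c b y)
  have "(\<Sum>d\<in>B. (b \<bullet> d) *\<^sub>R d) = (\<Sum>d\<in>B. if b = d then d else 0)"
    using step orthonormal_inner[OF assms(2,3)] by (intro sum.cong) auto
  then have "(\<Sum>d\<in>B. (b \<bullet> d) *\<^sub>R d) = b"
    using step assms(1) by simp
  moreover have "(\<Sum>d\<in>B. ((c *\<^sub>R b + y) \<bullet> d) *\<^sub>R d)
      = c *\<^sub>R (\<Sum>d\<in>B. (b \<bullet> d) *\<^sub>R d) + (\<Sum>d\<in>B. (y \<bullet> d) *\<^sub>R d)"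
    by (simp add: inner_add_left scaleR_left_distrib sum.distrib scaleR_sum_right)
  ultimately show ?case using step by simp
qed simp

text \<open>In an orthonormal eigenbasis the form is the sum of the squared coordinates weighted by
  the eigenvalues. The bound \<open>m\<close> will be the square of \<open>\<sigma>\<close>.\<close>

lemma quadratic_form_le_on_span:
  fixes B :: "'a::real_inner set"
  assumes B: "finite B" "pairwise orthogonal B" "\<forall>b\<in>B. norm b = 1"
    and f: "linear f" "\<And>b. b \<in> B \<Longrightarrow> f b = l b *\<^sub>R b" "\<And>b. b \<in> B \<Longrightarrow> l b \<le> m"
    and x: "x \<in> span B"
  shows "x \<bullet> f x \<le> m * (x \<bullet> x)"
proof -
  note ex = orthonormal_expansion[OF B x]
  have "f x = (\<Sum>b\<in>B. (x \<bullet> b) *\<^sub>R (l b *\<^sub>R b))"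
    by (subst ex) (use f in \<open>simp add: linear_sum linear_scale\<close>)
  then have "x \<bullet> f x = (\<Sum>b\<in>B. l b * (x \<bullet> b)\<^sup>2)"
    by (simp add: inner_sum_right power2_eq_square mult_ac)
  also have "\<dots> \<le> (\<Sum>b\<in>B. m * (x \<bullet> b)\<^sup>2)"
    using f(3) by (intro sum_mono mult_right_mono) auto
  also have "\<dots> = m * (x \<bullet> (\<Sum>b\<in>B. (x \<bullet> b) *\<^sub>R b))"
    by (simp add: inner_sum_right power2_eq_square sum_distrib_left)
  finally show ?thesis using ex by simp
qed

subsection \<open>Eigenvalues, the characteristic polynomial and singular values\<close>

lemma charpoly_similar_diagonal:
  fixes S P :: "real^'n^'n"
  assumes P: "orthogonal_matrix P" and SP: "S ** P = P ** diag_mat d"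
  shows "charpoly S = (\<Prod>i\<in>UNIV. [:- d $ i, 1:])"
proof -
  \<comment> \<open>\<open>C\<close> embeds real matrices as constant polynomial matrices and
    \<open>X\<close> is the indeterminate times the identity. The similarity is carried out over
    polynomials, where the nonzero determinant of \<open>C P\<close> can be cancelled.\<close>
  define C :: "real^'n^'n \<Rightarrow> real poly^'n^'n" where "C A = (\<chi> i j. [:A $ i $ j:])" for A
  define X :: "real poly^'n^'n" where "X = mat [:0, 1:]"
  have C_mult: "C (A ** A') = C A ** C A'" for A A'
  proof -
    have "[:\<Sum>k\<in>K. g k:] = (\<Sum>k\<in>K. [:g k:])" for g :: "'n \<Rightarrow> real" and K
      by (induction K rule: infinite_finite_induct) (simp_all, metis add_pCons add_0)
    then show ?thesis by (simp add: C_def matrix_matrix_mult_def vec_eq_iff mult.commute)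
  qed
  have cp: "charpoly A = det (X - C A)" for A
    unfolding charpoly_def X_def C_def
    by (intro arg_cong[where f = det]) (simp add: vec_eq_iff mat_def)
  have X_comm: "X ** A = A ** X" for A
    by (simp add: X_def mat_def matrix_matrix_mult_def vec_eq_iff if_distrib if_distribR
        mult.commute cong: if_cong)
  have "C P ** C (transpose P) = C (mat 1)"
    using P by (simp add: C_mult[symmetric] orthogonal_matrix_def)
  also have "C (mat 1) = mat 1" by (simp add: C_def mat_def vec_eq_iff)
  finally have "det (C P) * det (C (transpose P)) = 1"
    by (metis det_mul det_I)
  then have nz: "det (C P) \<noteq> 0" by auto
  have "(X - C S) ** C P = C P ** (X - C (diag_mat d))"
  proof -
    have "(X - C S) ** C P = X ** C P - C S ** C P"
      by (simp add: matrix_matrix_mult_def vec_eq_iff left_diff_distrib sum_subtractf)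
    also have "\<dots> = C P ** X - C P ** C (diag_mat d)"
      by (simp add: X_comm SP flip: C_mult)
    also have "\<dots> = C P ** (X - C (diag_mat d))"
      by (simp add: matrix_matrix_mult_def vec_eq_iff right_diff_distrib sum_subtractf)
    finally show ?thesis .
  qed
  then have "det (X - C S) * det (C P) = det (C P) * det (X - C (diag_mat d))"
    by (metis det_mul)
  then have "charpoly S = det (X - C (diag_mat d))" using nz by (simp add: cp)
  also have "\<dots> = (\<Prod>i\<in>UNIV. (X - C (diag_mat d)) $ i $ i)"
    by (rule det_diagonal) (simp add: X_def C_def mat_def diag_mat_def)
  also have "\<dots> = (\<Prod>i\<in>UNIV. [:- d $ i, 1:])"
    by (intro prod.cong) (auto simp: X_def C_def mat_def diag_mat_def)
  finally show ?thesis .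
qed

text \<open>Taken as columns, the eigenvectors form an orthogonal matrix that diagonalises
  \<open>S\<close>. The multiset image keeps the multiplicity of an eigenvalue shared by several
  basis vectors.\<close>

lemma proots_charpoly_orthonormal_eigenbasis:
  fixes S :: "real^'n^'n"
  assumes B: "finite B" "pairwise orthogonal B" "\<forall>b\<in>B. norm b = 1" "card B = CARD('n)"
    and S: "\<And>b. b \<in> B \<Longrightarrow> S *v b = l b *\<^sub>R b"
  shows "proots (charpoly S) = image_mset l (mset_set B)"
proof -
  obtain e :: "'n \<Rightarrow> real^'n" where e: "bij_betw e UNIV B"
    using B by (metis finite_same_card_bij finite_class.finite_UNIV)
  then have eB: "e i \<in> B" for i by (auto simp: bij_betw_def)
  define P :: "real^'n^'n" where "P = (\<chi> i j. e j $ i)"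
  have "e i \<bullet> e j = (if i = j then 1 else 0)" for i j
    using orthonormal_inner[OF B(2,3) eB eB] e by (auto simp: bij_betw_def inj_on_def)
  then have "orthogonal_matrix P"
    by (simp add: orthogonal_matrix P_def transpose_def matrix_matrix_mult_def mat_def
        vec_eq_iff inner_vec_def)
  moreover have "S ** P = P ** diag_mat (\<chi> i. l (e i))"
  proof -
    have "(S *v e j) $ i = l (e j) * e j $ i" for i j
      by (simp add: S[OF eB])
    then show ?thesis
      by (simp add: P_def diag_mat_def matrix_matrix_mult_def matrix_vector_mult_def vec_eq_iff
          if_distrib mult.commute cong: if_cong)
  qed
  ultimately have "charpoly S = (\<Prod>i\<in>UNIV. [:- l (e i), 1:])"
    using charpoly_similar_diagonal by fastforce
  then have "proots (charpoly S) = (\<Sum>i\<in>UNIV. {#l (e i)#})"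
    by (simp add: proots_prod)
  also have "\<dots> = (\<Sum>b\<in>B. {#l b#})"
    by (rule sum.reindex_bij_betw[OF e])
  also have "\<dots> = image_mset l (mset_set B)"
    using B(1) by (induction B rule: finite_induct) auto
  finally show ?thesis .
qed

text \<open>Used to peel the singular value 1 of \<open>v\<close> off the end of the sorted
  list.\<close>

lemma sorted_list_of_multiset_add_max:
  fixes M :: "'a::linorder multiset"
  assumes "\<And>y. y \<in># M \<Longrightarrow> y \<le> x"
  shows "sorted_list_of_multiset (add_mset x M) = sorted_list_of_multiset M @ [x]"
proof -
  have "sort (sorted_list_of_multiset M @ [x]) = sorted_list_of_multiset M @ [x]"
    using assms by (intro sorted_sort_id) (auto simp: sorted_append)
  moreover have "add_mset x M = mset (sorted_list_of_multiset M @ [x])" by simp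
  ultimately show ?thesis by (metis sorted_list_of_multiset_mset)
qed

lemma last_sorted_list_of_multiset:
  fixes M :: "'a::linorder multiset"
  assumes "M \<noteq> {#}"
  shows "last (sorted_list_of_multiset M) \<in># M"
    and "y \<in># M \<Longrightarrow> y \<le> last (sorted_list_of_multiset M)"
proof -
  let ?xs = "sorted_list_of_multiset M"
  have ne: "?xs \<noteq> []" using assms by (metis mset_sorted_list_of_multiset mset.simps(1))
  then show "last ?xs \<in># M" by (metis last_in_set set_sorted_list_of_multiset)
  assume "y \<in># M"
  then have "y \<in> set ?xs" by simp
  moreover have "sorted (butlast ?xs @ [last ?xs])" using ne by simp
  ultimately show "y \<le> last ?xs"
    using ne by (metis Un_iff append_butlast_last_id empty_iff empty_set insert_iff order_refl set_append
        list.simps(15) sorted_append)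
qed

subsection \<open>The contraction estimate\<close>

text \<open>Jensen's inequality with its defect, which is the total variance of \<open>z\<close> under the rows of \<open>W\<close>.\<close>

lemma stochastic_variance_identity:
  fixes W :: "real^'n^'n"
  assumes "W *v 1 = 1" "q v* W = q"
  shows "(\<Sum>i\<in>UNIV. q $ i * ((W *v z) $ i)\<^sup>2) +
         (\<Sum>i\<in>UNIV. \<Sum>j\<in>UNIV. q $ i * W $ i $ j * (z $ j - (W *v z) $ i)\<^sup>2)
       = (\<Sum>j\<in>UNIV. q $ j * (z $ j)\<^sup>2)"
proof -
  have row: "(\<Sum>j\<in>UNIV. W $ i $ j) = 1" for i
    using assms(1) by (simp add: matrix_vector_mult_def vec_eq_iff)
  have col: "(\<Sum>i\<in>UNIV. q $ i * W $ i $ j) = q $ j" for j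
    using assms(2) by (simp add: vector_matrix_mult_def vec_eq_iff mult.commute)
  have "(\<Sum>j\<in>UNIV. q $ i * W $ i $ j * (z $ j - (W *v z) $ i)\<^sup>2)
      = (\<Sum>j\<in>UNIV. q $ i * W $ i $ j * (z $ j)\<^sup>2) - q $ i * ((W *v z) $ i)\<^sup>2" for i
  proof -
    define m where "m = (W *v z) $ i"
    have m: "(\<Sum>j\<in>UNIV. W $ i $ j * z $ j) = m"
      by (simp add: m_def matrix_vector_mult_def)
    have "(\<Sum>j\<in>UNIV. q $ i * W $ i $ j * (z $ j - m)\<^sup>2)
      = (\<Sum>j\<in>UNIV. q $ i * W $ i $ j * (z $ j)\<^sup>2 - 2 * q $ i * m * (W $ i $ j * z $ j)
            + q $ i * m\<^sup>2 * W $ i $ j)"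
      by (intro sum.cong) (auto simp: power2_eq_square algebra_simps)
    also have "\<dots> = (\<Sum>j\<in>UNIV. q $ i * W $ i $ j * (z $ j)\<^sup>2) - 2 * q $ i * m * m + q $ i * m\<^sup>2"
      by (simp add: sum.distrib sum_subtractf row m flip: sum_distrib_left)
    finally show ?thesis by (simp add: m_def power2_eq_square)
  qed
  then have "(\<Sum>i\<in>UNIV. q $ i * ((W *v z) $ i)\<^sup>2) +
         (\<Sum>i\<in>UNIV. \<Sum>j\<in>UNIV. q $ i * W $ i $ j * (z $ j - (W *v z) $ i)\<^sup>2)
       = (\<Sum>i\<in>UNIV. \<Sum>j\<in>UNIV. q $ i * W $ i $ j * (z $ j)\<^sup>2)"
    by (simp add: sum_subtractf)
  also have "\<dots> = (\<Sum>j\<in>UNIV. \<Sum>i\<in>UNIV. q $ i * W $ i $ j * (z $ j)\<^sup>2)"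
    by (rule sum.swap)
  also have "\<dots> = (\<Sum>j\<in>UNIV. q $ j * (z $ j)\<^sup>2)"
    by (simp add: col flip: sum_distrib_right)
  finally show ?thesis .
qed

lemma strongly_connected_constant:
  assumes "strongly_connected (with_proj G)" "pverts G = UNIV"
    and "\<And>i j. (i, j) \<in> parcs G \<Longrightarrow> z i = z j"
  shows "z i = z j"
proof -
  have "reachable (with_proj G) i j"
    using assms(1,2) by (auto simp: strongly_connected_def)
  then have "(i, j) \<in> rtrancl_on UNIV (parcs G)"
    using assms(2) by (simp add: reachable_def arcs_ends_def arc_to_ends_def)
  then show ?thesis
    by (induction rule: rtrancl_on_induct) (use assms(3) in auto)
qed

text \<open>Without a strict drop the variance defect would vanish, hence so would each of its
  nonnegative terms. This makes \<open>z\<close> constant, and a constant vector with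
  \<open>q\<close>-mean 0 is zero.\<close>

lemma stochastic_strict_contraction:
  fixes W :: "real^'n^'n"
  assumes "strongly_connected (with_proj G)" "pverts G = UNIV"
    and adj: "weighted_adjacency_matrix G W" and diag: "\<forall>i. W $ i $ i > 0"
    and W: "row_stochastic W" and q: "left_perron_vector W q"
    and z: "q \<bullet> z = 0" "z \<noteq> 0"
  shows "(\<Sum>i\<in>UNIV. q $ i * ((W *v z) $ i)\<^sup>2) < (\<Sum>i\<in>UNIV. q $ i * (z $ i)\<^sup>2)"
proof (rule ccontr)
  let ?D = "\<lambda>i j. q $ i * W $ i $ j * (z $ j - (W *v z) $ i)\<^sup>2"
  assume "\<not> ?thesis"
  moreover have "W *v 1 = 1" "q v* W = q"
    using W q by (auto simp: row_stochastic_def left_perron_vector_def)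
  moreover have D0: "?D i j \<ge> 0" for i j
    using W q by (auto simp: row_stochastic_def left_perron_vector_def intro!: mult_nonneg_nonneg intro: less_imp_le)
  ultimately have "(\<Sum>i\<in>UNIV. \<Sum>j\<in>UNIV. ?D i j) = 0"
    using stochastic_variance_identity[of W q z] sum_nonneg[of UNIV "\<lambda>i. \<Sum>j\<in>UNIV. ?D i j"]
    by (smt (verit) sum_nonneg)
  then have D: "?D i j = 0" for i j
    using D0 by (auto simp: sum_nonneg_eq_0_iff sum_nonneg)
  then have eq: "z $ j = (W *v z) $ i" if "W $ i $ j > 0" for i j
  proof -
    have "q $ i > 0" using q by (simp add: left_perron_vector_def)
    then show ?thesis using that D[of i j] by simp
  qed
  \<comment> \<open>The self-loop at \<open>i\<close> and the arc to \<open>j\<close> equate both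
    \<open>z $ i\<close> and \<open>z $ j\<close> with the same average
    \<open>(W *v z) $ i\<close>.\<close>
  have "z $ i = z $ j" if "(i, j) \<in> parcs G" for i j
    using that adj diag eq[of i i] eq[of i j] by (simp add: weighted_adjacency_matrix_def)
  then have const: "z $ i = z $ j" for i j
    using strongly_connected_constant[OF assms(1,2), of "\<lambda>i. z $ i"] by blast
  obtain k where k: "z $ k \<noteq> 0" using z(2) by (auto simp: vec_eq_iff)
  have "q \<bullet> z = (\<Sum>i\<in>UNIV. q $ i * z $ k)"
    unfolding inner_vec_def by (intro sum.cong refl) (metis const inner_real_def)
  also have "\<dots> = (1 \<bullet> q) * z $ k"
    by (simp add: inner_vec_def sum_distrib_right)
  finally show False using q k z(1) by (simp add: left_perron_vector_def)
qed

lemma diag_mat_mult_nth [simp]: "(diag_mat d *v x) $ i = d $ i * x $ i"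
  by (simp add: diag_mat_def matrix_vector_mult_def mult_delta_left)

lemma weighted_norm_diag_mat: "weighted_norm (diag_mat d) x = sqrt (\<Sum>i\<in>UNIV. d $ i * (x $ i)\<^sup>2)"
  by (simp add: weighted_norm_def inner_vec_def power2_eq_square mult_ac)

theorem lemma1:
  fixes G :: "'n::finite pair_pre_digraph"
    and W Q Q_half Q_neg_half :: "real^'n^'n"
    and q :: "real^'n"
    and \<sigma> :: real
  assumes "CARD('n) \<ge> 2"
    and "pverts G = UNIV"
    and "strongly_connected (with_proj G)"
    and "weighted_adjacency_matrix G W"
    and "\<forall>i. W $ i $ i > 0"
    and "row_stochastic W"
    and "left_perron_vector W q"
    and "Q = diag_mat q"
    and "Q_half = diag_mat (\<chi> i. sqrt (q $ i))"
    and "Q_neg_half = diag_mat (\<chi> i. 1 / sqrt (q $ i))"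
    and "\<sigma> = singular_value (CARD('n) - 1) (Q_half ** W ** Q_neg_half)"
  shows "\<sigma> < 1 \<and>
         (\<forall>y :: real^'n.
            weighted_norm Q (W *v (y - (q \<bullet> y) *\<^sub>R 1))
              \<le> \<sigma> * weighted_norm Q (y - (q \<bullet> y) *\<^sub>R 1))"
proof -
  define A where "A = Q_half ** W ** Q_neg_half"
  define S where "S = transpose A ** A"
  define v :: "real^'n" where "v = (\<chi> i. sqrt (q $ i))"
  define V where "V = {x. v \<bullet> x = 0}"
  have qW: "q v* W = q" and q1: "1 \<bullet> q = 1" and "\<forall>i. q $ i > 0"
    using assms(7) by (auto simp: left_perron_vector_def)
  then have qpos: "q $ i > 0" for i by blast
  have W1: "W *v 1 = 1" using assms(6) by (simp add: row_stochastic_def)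
  \<comment> \<open>The substitution \<open>x = Q_half *v z\<close> turns \<open>W\<close> into
    \<open>A\<close>, the \<open>Q\<close>-norm into the Euclidean norm and pairing with
    \<open>q\<close> into pairing with \<open>v\<close>.\<close>
  have A_mult: "A *v (Q_half *v z) = Q_half *v (W *v z)" for z
  proof -
    have "Q_neg_half *v (Q_half *v z) = z"
      using qpos by (simp add: assms(9,10) vec_eq_iff less_imp_neq[THEN not_sym])
    then show ?thesis by (simp add: A_def flip: matrix_vector_mul_assoc)
  qed
  have norm_half: "(Q_half *v z) \<bullet> (Q_half *v z) = (\<Sum>i\<in>UNIV. q $ i * (z $ i)\<^sup>2)" for z
    using qpos[THEN less_imp_le] by (simp add: assms(9) inner_vec_def power2_eq_square algebra_simps)
  have half_surj: "x = Q_half *v (Q_neg_half *v x)" for x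
    using qpos by (simp add: assms(9,10) vec_eq_iff less_imp_neq[THEN not_sym])
  have v_half: "v \<bullet> (Q_half *v z) = q \<bullet> z" for z
    using qpos[THEN less_imp_le] by (simp add: v_def assms(9) inner_vec_def flip: mult.assoc)
  have v1: "v = Q_half *v 1" by (simp add: v_def assms(9) vec_eq_iff)
  have vv: "v \<bullet> v = 1" using v_half[of 1] q1 by (simp add: v1[symmetric] inner_commute)
  have Av: "A *v v = v" by (simp add: v1 A_mult W1)
  \<comment> \<open>This is the weak form of \<open>v\<close> being fixed by the transpose of
    \<open>A\<close>; it comes from \<open>q\<close> being a left eigenvector of
    \<open>W\<close>.\<close>
  have vA: "v \<bullet> (A *v x) = v \<bullet> x" for x
  proof -
    have "v \<bullet> (A *v x) = q \<bullet> (W *v (Q_neg_half *v x))"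
      by (metis half_surj A_mult v_half)
    also have "\<dots> = q \<bullet> (Q_neg_half *v x)"
      by (simp add: qW flip: dot_lmul_matrix)
    also have "\<dots> = v \<bullet> x" by (metis half_surj v_half)
    finally show ?thesis .
  qed
  have S_inner: "x \<bullet> (S *v y) = (A *v x) \<bullet> (A *v y)" for x y
    by (metis S_def matrix_vector_mul_assoc dot_lmul_matrix vector_transpose_matrix)
  have adj: "(S *v x) \<bullet> y = x \<bullet> (S *v y)" for x y
    by (metis S_inner inner_commute)
  have vS: "v \<bullet> (S *v x) = v \<bullet> x" for x by (simp add: S_inner Av vA)
  have Sv: "S *v v = v"
    by (metis adj vS inner_commute vector_eq_rdot)
  have V: "subspace V" by (simp add: V_def subspace_def inner_add_right)
  have SV: "S *v x \<in> V" if "x \<in> V" for x using that by (simp add: V_def vS)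
  obtain B where B: "B \<subseteq> V" "finite B" "pairwise orthogonal B" "\<forall>b\<in>B. norm b = 1"
      "span B = V" "\<forall>b\<in>B. \<exists>l. S *v b = l *\<^sub>R b"
    using self_adjoint_orthonormal_eigenbasis[OF matrix_vector_mul_linear adj V] SV
    by blast
  \<comment> \<open>On unit eigenvectors this recovers the eigenvalue, at \<open>v\<close> as well
    as on \<open>B\<close>. It equals the squared norm of \<open>A *v b\<close>, whence
    nonnegativity.\<close>
  define l where "l b = b \<bullet> (S *v b)" for b
  have l: "S *v b = l b *\<^sub>R b" if "b \<in> B" for b
    using B that by (auto simp: l_def dot_square_norm)
  have l_less: "0 \<le> l b \<and> l b < 1" if "b \<in> B" for b
  proof -
    obtain z where z: "b = Q_half *v z" using half_surj by blast
    have "b \<bullet> b = 1" "b \<in> V" using B that by (auto simp: dot_square_norm)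
    then have "q \<bullet> z = 0" "z \<noteq> 0" using v_half z by (auto simp: V_def)
    from stochastic_strict_contraction[OF assms(3,2,4,5,6,7) this]
    have "l b < b \<bullet> b" by (simp add: l_def S_inner z A_mult norm_half)
    then show ?thesis using \<open>b \<bullet> b = 1\<close> by (simp add: l_def S_inner)
  qed
  have "v \<notin> B" using B(1) vv by (auto simp: V_def)
  have orth: "pairwise orthogonal (insert v B)"
    using B by (auto simp: pairwise_insert orthogonal_def V_def inner_commute)
  have nrm: "\<forall>b\<in>insert v B. norm b = 1" using B vv by (auto simp: norm_eq_sqrt_inner)
  have "span (insert v B) = UNIV"
  proof -
    have "x - (v \<bullet> x) *\<^sub>R v \<in> V" for x by (simp add: V_def inner_diff_right vv)
    then show ?thesis using B(5) span_breakdown_eq by blast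
  qed
  moreover have "independent (insert v B)"
    using orth nrm by (intro pairwise_orthogonal_independent) auto
  ultimately have card: "card (insert v B) = CARD('n)"
    using basis_card_eq_dim[of "insert v B" "UNIV :: (real^'n) set"] by simp
  define M where "M = image_mset (\<lambda>b. sqrt (l b)) (mset_set B)"
  have "l v = 1" by (simp add: l_def Sv vv)
  have "proots (charpoly S) = image_mset l (mset_set (insert v B))"
    using B Sv l \<open>l v = 1\<close> orth nrm card by (intro proots_charpoly_orthonormal_eigenbasis) auto
  then have "image_mset sqrt (proots (charpoly S)) = add_mset 1 M"
    using \<open>v \<notin> B\<close> B(2) by (simp add: M_def \<open>l v = 1\<close> image_mset.compositionality o_def)
  moreover have M_iff: "s \<in># M \<longleftrightarrow> (\<exists>b\<in>B. s = sqrt (l b))" for s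
    using B(2) by (auto simp: M_def)
  ultimately have sv: "singular_values A = sorted_list_of_multiset M @ [1]"
    using l_less unfolding singular_values_def S_def
    by (subst sorted_list_of_multiset_add_max[symmetric]) (auto simp: less_imp_le)
  have len: "length (sorted_list_of_multiset M) = CARD('n) - 1"
    using card \<open>v \<notin> B\<close> B(2)
    by (metis M_def card_insert_disjoint diff_Suc_1 mset_sorted_list_of_multiset size_image_mset
        size_mset size_mset_set)
  \<comment> \<open>Dimension at least 2 leaves a singular value besides the 1 of
    \<open>v\<close>.\<close>
  then have "M \<noteq> {#}" using assms(1) by auto
  \<comment> \<open>One-based index \<open>CARD('n) - 1\<close> is list position
    \<open>CARD('n) - 2\<close>, the last place of the \<open>CARD('n) - 1\<close> entries from
    \<open>M\<close>, just before the final 1.\<close>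
  have "\<sigma> = last (sorted_list_of_multiset M)"
    using len assms(1)
    by (simp add: assms(11) singular_value_def A_def[symmetric] sv nth_append last_conv_nth
        flip: length_greater_0_conv)
  then have \<sigma>: "\<sigma> \<in># M" "\<And>s. s \<in># M \<Longrightarrow> s \<le> \<sigma>"
    using last_sorted_list_of_multiset[OF \<open>M \<noteq> {#}\<close>] by auto
  then have \<sigma>1: "0 \<le> \<sigma>" "\<sigma> < 1" using M_iff l_less by auto
  have l_le: "l b \<le> \<sigma>\<^sup>2" if "b \<in> B" for b
    using \<sigma>(2)[of "sqrt (l b)"] that l_less M_iff \<sigma>1 by (auto intro: sqrt_le_D)
  have "weighted_norm Q (W *v z) \<le> \<sigma> * weighted_norm Q z" if "q \<bullet> z = 0" for z
  proof -
    have "Q_half *v z \<in> span B" using that by (simp add: B(5) V_def v_half)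
    from quadratic_form_le_on_span[OF B(2-4) matrix_vector_mul_linear l l_le this]
    have "(Q_half *v z) \<bullet> (S *v (Q_half *v z)) \<le> \<sigma>\<^sup>2 * ((Q_half *v z) \<bullet> (Q_half *v z))"
      by simp
    then have "(\<Sum>i\<in>UNIV. q $ i * ((W *v z) $ i)\<^sup>2) \<le> \<sigma>\<^sup>2 * (\<Sum>i\<in>UNIV. q $ i * (z $ i)\<^sup>2)"
      by (simp add: S_inner A_mult norm_half)
    then have "weighted_norm Q (W *v z) \<le> sqrt (\<sigma>\<^sup>2 * (\<Sum>i\<in>UNIV. q $ i * (z $ i)\<^sup>2))"
      by (simp add: assms(8) weighted_norm_diag_mat)
    then show ?thesis
      using \<sigma>1 by (simp add: assms(8) weighted_norm_diag_mat real_sqrt_mult)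
  qed
  moreover have "q \<bullet> (y - (q \<bullet> y) *\<^sub>R 1) = 0" for y
    using q1 by (simp add: inner_diff_right inner_commute)
  ultimately show ?thesis using \<sigma>1 by blast
qed

end
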